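(* Let $p$ be a prime and $n>1$ a natural number. Let $\mathcal{F}$ be a linear cellular automaton over the alphabet $(\mathbb{Z}/p\mathbb{Z})^n$ and let $A\in(\mathbb{Z}/p\mathbb{Z}[X,X^{-1}])^{n\times n}$ be the matrix associated with $\mathcal{F}$. Then $\mathcal{F}$ is positively expansive if and only if $A$ is expansive.
   Context: For a natural $m>1$, write $\mathbb{L}_m=\mathbb{Z}/m\mathbb{Z}[X,X^{-1}]$ (Laurent polynomials). A linear cellular automaton (LCA) over $(\mathbb{Z}/m\mathbb{Z})^n$ is a map $\mathcal{F}:((\mathbb{Z}/m\mathbb{Z})^n)^{\mathbb{Z}}\to((\mathbb{Z}/m\mathbb{Z})^n)^{\mathbb{Z}}$ given, for some radius $r\in\mathbb{N}$ and matrices $A_{-r},\dots,A_r\in(\mathbb{Z}/m\mathbb{Z})^{n\times n}$, by $\mathcal{F}(c)_i=\sum_{j=-r}^{r}A_j c_{i+j}$ for all $c$ and $i\in\mathbb{Z}$; its associated matrix is $A=\sum_{j=-r}^r A_jX^{-j}\in\mathbb{L}_m^{n\times n}$. The configuration space carries the metric $d(c,c')=2^{-\min\{|j|:c_j\neq c'_j\}}$ for $c\neq c'$ and $d(c,c)=0$. $\mathcal{F}$ is positively expansive if there is $\varepsilon>0$ such that for all configurations $c\neq c'$ there is $\ell\in\mathbb{N}$ with $d(\mathcal{F}^\ell(c),\mathcal{F}^\ell(c'))\geq\varepsilon$. For a nonzero $\alpha\in\mathbb{L}_m$, $\deg^+(\alpha)$ (resp. $\deg^-(\alpha)$) is the largest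 (resp. smallest) exponent of a monomial of $\alpha$ with nonzero coefficient; $\deg^+(0)=-\infty$, $\deg^-(0)=+\infty$. A monic polynomial $\pi(t)=\alpha_0+\alpha_1t+\dots+\alpha_{n-1}t^{n-1}+t^n\in\mathbb{L}_m[t]$ is expansive if $\alpha_0\neq0$ and (i) $\deg^+(\alpha_0)>0$ and $\deg^+(\alpha_0)>\deg^+(\alpha_i)$ for all $i\in\{1,\dots,n-1\}$, and (ii) $\deg^-(\alpha_0)<0$ and $\deg^-(\alpha_0)<\deg^-(\alpha_i)$ for all $i\in\{1,\dots,n-1\}$. A matrix $A\in\mathbb{L}_m^{n\times n}$ is expansive if its characteristic polynomial $\det(tI_n-A)$ is expansive. *)

theory Defs
  imports "Berlekamp_Zassenhaus.Finite_Field"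
          "Jordan_Normal_Form.Char_Poly"
          "HOL-Computational_Algebra.Formal_Laurent_Series"
begin

(* The field Z/pZ is the type 'p mod_ring with 'p :: prime_card, p = CARD('p).
   The alphabet (Z/pZ)^n consists of vectors 'p mod_ring vec of dimension n.
   A configuration is a map  int => 'p mod_ring vec  all of whose values have dimension n.
   Laurent polynomials Z/pZ[X,X^-1] are represented inside the ring of formal Laurent
   series 'a fls (they are exactly the finitely supported ones). *)

definition is_config :: "nat \<Rightarrow> (int \<Rightarrow> 'a vec) \<Rightarrow> bool" where
  "is_config n c \<longleftrightarrow> (\<forall>i. dim_vec (c i) = n)"

definition lca :: "nat \<Rightarrow> nat \<Rightarrow> (int \<Rightarrow> 'a::comm_ring_1 mat) \<Rightarrow> (int \<Rightarrow> 'a vec) \<Rightarrow> (int \<Rightarrow> 'a vec)" where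
  "lca n r Aj c = (\<lambda>i. vec n (\<lambda>k. \<Sum>j\<in>{-int r..int r}. (Aj j *\<^sub>v c (i + j)) $ k))"

definition lca_matrix :: "nat \<Rightarrow> nat \<Rightarrow> (int \<Rightarrow> 'a::comm_ring_1 mat) \<Rightarrow> 'a fls mat" where
  "lca_matrix n r Aj = mat n n (\<lambda>(k,l). \<Sum>j\<in>{-int r..int r}.
       fls_const (index_mat (Aj j) (k,l)) * fls_X_intpow (- j))"

definition config_dist :: "(int \<Rightarrow> 'a) \<Rightarrow> (int \<Rightarrow> 'a) \<Rightarrow> real" where
  "config_dist c c' = (if c = c' then 0
     else (1/2) ^ (LEAST m::nat. \<exists>j. nat \<bar>j\<bar> = m \<and> c j \<noteq> c' j))"

definition positively_expansive :: "nat \<Rightarrow> ((int \<Rightarrow> 'a vec) \<Rightarrow> (int \<Rightarrow> 'a vec)) \<Rightarrow> bool" where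
  "positively_expansive n F \<longleftrightarrow> (\<exists>e>0. \<forall>c c'. is_config n c \<longrightarrow> is_config n c' \<longrightarrow> c \<noteq> c' \<longrightarrow>
      (\<exists>l::nat. config_dist ((F ^^ l) c) ((F ^^ l) c') \<ge> e))"

definition deg_plus :: "'a::zero fls \<Rightarrow> int" where
  "deg_plus f = Max {k. fls_nth f k \<noteq> 0}"

definition deg_minus :: "'a::zero fls \<Rightarrow> int" where
  "deg_minus f = fls_subdegree f"

(* Expansive polynomial  pi(t) = a_0 + a_1 t + ... + a_{n-1} t^{n-1} + t^n  (n = degree pi);
   the conventions deg^+(0) = -inf and deg^-(0) = +inf are written out as "a_i = 0 \<or> ...". *)
definition expansive_poly :: "'a::zero fls poly \<Rightarrow> bool" where
  "expansive_poly \<pi> \<longleftrightarrow> coeff \<pi> 0 \<noteq> 0 \<and>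
     deg_plus (coeff \<pi> 0) > 0 \<and>
     (\<forall>i\<in>{1..<degree \<pi>}. coeff \<pi> i = 0 \<or> deg_plus (coeff \<pi> 0) > deg_plus (coeff \<pi> i)) \<and>
     deg_minus (coeff \<pi> 0) < 0 \<and>
     (\<forall>i\<in>{1..<degree \<pi>}. coeff \<pi> i = 0 \<or> deg_minus (coeff \<pi> 0) < deg_minus (coeff \<pi> i))"

definition expansive_mat :: "'a::comm_ring_1 fls mat \<Rightarrow> bool" where
  "expansive_mat A \<longleftrightarrow> expansive_poly (char_poly A)"

end

theory Submission
  imports Defs "HOL-Library.Poly_Mapping"
begin

text \<open>
  Write \<open>k = Z/pZ\<close> and \<open>L = k[X, 1/X]\<close>, and let \<open>\<chi>\<close> be the characteristic polynomial of \<open>A\<close>.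
  A configuration is the same thing as a \<open>k\<close>-linear functional on the row vectors \<open>L\<^sup>n\<close>, and under this
  duality the automaton is the transpose of multiplication by \<open>A\<close>. Hence the automaton is positively
  expansive iff, for some \<open>M\<close>, the rows of all \<open>X\<^sup>x A\<^sup>t\<close> with \<open>\<bar>x\<bar> \<le> M\<close> span \<open>L\<^sup>n\<close> over \<open>k\<close>; that is, iff
  \<open>L\<^sup>n\<close> is finitely generated over \<open>k[t]\<close>, where \<open>t\<close> acts as \<open>A\<close>.

  If so, then modulo the rows of \<open>t I - A\<close> the vectors \<open>X\<^sup>S e\<^sub>i\<close> with \<open>S = M + 1\<close> are combinations of the
  \<open>e\<^sub>l\<close> with coefficients of \<open>X\<close>-degree in \<open>[-M, M]\<close>, so \<open>X\<^sup>S I - Q = B (t I - A)\<close> and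
  \<open>det (X\<^sup>S I - Q) = det B \<cdot> \<chi>\<close>. Read as Laurent polynomials in \<open>X\<close> over the domain \<open>k[t]\<close>, the left-hand
  side has leading coefficient \<open>1\<close>, so the leading coefficient of \<open>\<chi>\<close> in \<open>X\<close> is a unit of \<open>k[t]\<close>, that is,
  it comes from the constant term of \<open>\<chi>\<close> alone. The same argument applies to \<open>1/X\<close>, and the two
  conditions together are expansivity of \<open>\<chi>\<close>.

  Conversely, by Cayley--Hamilton the orbit of a configuration satisfies the linear recurrence given by
  \<open>\<chi>\<close>. If \<open>\<chi>\<close> is expansive, its two extreme powers of \<open>X\<close> occur only in the constant term, so vanishing
  of the whole orbit on a long enough window propagates to the left and to the right.
\<close>

no_notation fps_nth (infixl \<open>$\<close> 75)

section \<open>Laurent polynomials\<close>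

text \<open>
  Inside \<open>'a fls\<close> the substitution \<open>X \<mapsto> 1/X\<close> is not a ring homomorphism. Working in \<open>int \<Rightarrow>\<^sub>0 'a\<close> instead
  lets the sign \<open>s = \<plusminus>1\<close> below treat both ends of a Laurent polynomial at once.
\<close>

type_synonym 'a laurent = "int \<Rightarrow>\<^sub>0 'a"

abbreviation lX :: "int \<Rightarrow> 'a::comm_ring_1 laurent" where
  "lX j \<equiv> Poly_Mapping.single j 1"

abbreviation lC :: "'a::comm_ring_1 \<Rightarrow> 'a laurent" where
  "lC a \<equiv> Poly_Mapping.single 0 a"

lemma poly_mapping_sum_single:
  "f = (\<Sum>k\<in>Poly_Mapping.keys f. Poly_Mapping.single k (Poly_Mapping.lookup f k))"
proof (rule poly_mapping_eqI)
  fix j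
  have "Poly_Mapping.lookup (\<Sum>k\<in>Poly_Mapping.keys f. Poly_Mapping.single k (Poly_Mapping.lookup f k)) j
     = (\<Sum>k\<in>Poly_Mapping.keys f. if k = j then Poly_Mapping.lookup f k else 0)"
    unfolding lookup_sum by (intro sum.cong) (auto simp: lookup_single when_def)
  also have "\<dots> = Poly_Mapping.lookup f j"
    by (auto simp: in_keys_iff)
  finally show "Poly_Mapping.lookup f j = Poly_Mapping.lookup
    (\<Sum>k\<in>Poly_Mapping.keys f. Poly_Mapping.single k (Poly_Mapping.lookup f k)) j" ..
qed

lemma poly_mapping_single_induct [case_names zero single add]:
  fixes f :: "'a \<Rightarrow>\<^sub>0 'b::comm_monoid_add"
  assumes "P 0" "\<And>k a. P (Poly_Mapping.single k a)" "\<And>f g. P f \<Longrightarrow> P g \<Longrightarrow> P (f + g)"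
  shows "P f"
proof -
  have "P (\<Sum>k\<in>S. Poly_Mapping.single k (Poly_Mapping.lookup f k))" if "finite S" for S
    using that by induction (auto intro: assms)
  then show ?thesis
    using poly_mapping_sum_single[of f] by (metis finite_keys)
qed

text \<open>For \<open>s = 1\<close> or \<open>s = -1\<close> this is the substitution of
  \<open>X^s\<close> for \<open>X\<close>, combined with a coefficient map \<open>h\<close>: the
  identity for comparison with \<open>lca_matrix\<close>, the embedding of constants into
  \<open>k[t]\<close> for \<open>swap_vars\<close>.\<close>

definition laurent_to_fls :: "int \<Rightarrow> ('a \<Rightarrow> 'b) \<Rightarrow> 'a::comm_ring_1 laurent \<Rightarrow> 'b::comm_ring_1 fls" where
  "laurent_to_fls s h f = Abs_fls (\<lambda>m. h (Poly_Mapping.lookup f (s * m)))"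

context comm_ring_hom
begin

lemma laurent_to_fls_nth [simp]:
  assumes "s * s = 1"
  shows "fls_nth (laurent_to_fls s hom f) m = hom (Poly_Mapping.lookup f (s * m))"
proof -
  \<comment> \<open>The reflected support bounds the nonzero coefficients from below;
    \<open>0\<close> is inserted so that \<open>Min\<close> is taken over a nonempty set.\<close>
  let ?K = "insert 0 ((\<lambda>k. s * k) ` Poly_Mapping.keys f)"
  have "hom (Poly_Mapping.lookup f (s * m)) = 0" if "m < Min ?K" for m
  proof -
    have "m \<notin> ?K" using that by (metis Min_le finite.insertI finite_imageI finite_keys not_less)
    moreover have "m = s * (s * m)" using assms by (metis mult.assoc mult_1)
    ultimately have "s * m \<notin> Poly_Mapping.keys f" by blast
    then show ?thesis by (simp add: in_keys_iff)
  qed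
  then show ?thesis
    unfolding laurent_to_fls_def by (intro nth_Abs_fls_lower_bound[of "Min ?K"]) blast
qed

lemma laurent_to_fls_single:
  assumes "s * s = 1"
  shows "laurent_to_fls s hom (Poly_Mapping.single k a) = fls_shift (- (s * k)) (fls_const (hom a))"
proof -
  have "k = s * m \<longleftrightarrow> s * k = m" for m
    using assms by (metis mult.assoc mult_1)
  then show ?thesis using assms
    by (intro fls_eqI) (auto simp: lookup_single when_def)
qed

text \<open>Both sides of the product rule are biadditive, so monomials suffice.\<close>

lemma laurent_to_fls_hom:
  assumes s: "s * s = 1"
  shows "comm_ring_hom (laurent_to_fls s hom)"
proof
  let ?h = "laurent_to_fls s hom"
  show z: "?h 0 = 0" using s by (intro fls_eqI) simp
  show add: "?h (f + g) = ?h f + ?h g" for f g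
    using s by (intro fls_eqI) (simp add: lookup_add hom_add)
  show "?h 1 = 1" 
    using laurent_to_fls_single[OF s, of 0 1] by simp
  show "?h (f * g) = ?h f * ?h g" for f g
  proof (induction f rule: poly_mapping_single_induct)
    case (single k a)
    show ?case
    proof (induction g rule: poly_mapping_single_induct)
      case (single l b)
      show ?case
        by (simp add: mult_single laurent_to_fls_single[OF s] hom_mult
            fls_shifted_times_simps distrib_left)
    qed (simp_all add: z add distrib_left)
  qed (simp_all add: z add distrib_right)
qed

end

lemma fps_to_fls_hom: "comm_ring_hom (fps_to_fls :: 'a::comm_ring_1 fps \<Rightarrow> 'a fls)"
  by unfold_locales (auto simp: fls_times_fps_to_fls)

lemma fps_nth_0_hom: "comm_ring_hom (\<lambda>f :: 'a::comm_ring_1 fps. fps_nth f 0)"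
  by unfold_locales (auto)

lemma pCons_hom: "comm_ring_hom (\<lambda>a :: 'a::comm_ring_1. [:a:])"
  by unfold_locales (auto simp: one_pCons)

text \<open>
  The embedding of \<open>k[X, 1/X][t]\<close> into the Laurent series in \<open>X\<^sup>s\<close> over \<open>k[t]\<close>.
\<close>

definition swap_vars :: "int \<Rightarrow> 'a::comm_ring_1 laurent poly \<Rightarrow> 'a poly fls" where
  "swap_vars s p = poly (map_poly (laurent_to_fls s (\<lambda>a. [:a:])) p) (fls_const [:0, 1:])"

context
  fixes s :: int
  assumes s: "s * s = 1"
begin

interpretation pC: comm_ring_hom "\<lambda>a :: 'a::comm_ring_1. [:a:]" by (rule pCons_hom)

interpretation lh: comm_ring_hom "laurent_to_fls s (\<lambda>a :: 'a::comm_ring_1. [:a:])"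
  by (rule pC.laurent_to_fls_hom[OF s])

interpretation mp: map_poly_comm_ring_hom "laurent_to_fls s (\<lambda>a :: 'a::comm_ring_1. [:a:])" ..

lemma swap_vars_hom: "comm_ring_hom (swap_vars s :: 'a::comm_ring_1 laurent poly \<Rightarrow> _)"
  unfolding swap_vars_def by unfold_locales (simp_all only: mp.hom_zero mp.hom_one mp.hom_add mp.hom_mult poly_0 poly_1 poly_add poly_mult)

lemma coeff_swap_vars: "coeff (fls_nth (swap_vars s p) m) i = Poly_Mapping.lookup (coeff p i) (s * m)"
proof -
  let ?l = "laurent_to_fls s (\<lambda>a :: 'a. [:a:])"
  define N where "N = max i (degree p)"
  have d: "degree (map_poly ?l p) \<le> N" by (simp add: N_def degree_map_poly_le le_max_iff_disj)
  have pw: "fls_const [:0, 1:] ^ i = fls_const (monom (1::'a) i)" for i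
    by (induction i) (auto simp: fls_const_mult_const monom_Suc simp flip: one_pCons)
  have extend: "(\<Sum>i\<le>degree q. coeff q i * g i) = (\<Sum>i\<le>N. coeff q i * g i)"
    if "degree q \<le> N" for q :: "'a poly fls poly" and g
    using that by (intro sum.mono_neutral_left) (auto simp: coeff_eq_0)
  have "swap_vars s p = (\<Sum>i\<le>degree (map_poly ?l p). coeff (map_poly ?l p) i * fls_const (monom 1 i))"
    unfolding swap_vars_def poly_altdef pw ..
  also note extend[OF d]
  finally have "swap_vars s p = (\<Sum>i\<le>N. ?l (coeff p i) * fls_const (monom 1 i))"
    by (simp add: coeff_map_poly)
  then have "fls_nth (swap_vars s p) m = (\<Sum>i\<le>N. [:Poly_Mapping.lookup (coeff p i) (s * m):] * monom 1 i)"
    using s by (simp add: fls_nth_sum pC.laurent_to_fls_nth)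
  then have "coeff (fls_nth (swap_vars s p) m) i = (\<Sum>j\<le>N. if j = i then Poly_Mapping.lookup (coeff p j) (s * m) else 0)"
    by (simp add: coeff_sum if_distrib cong: if_cong)
  then show ?thesis by (simp add: N_def)
qed

end

section \<open>The characteristic polynomial\<close>

text \<open>Taking \<open>X^(-S)\<close> out of every row leaves \<open>G = I - X^S Q\<close>. By
  \<open>low\<close>, only positive exponents occur in \<open>X^S Q\<close>, so \<open>G\<close> has
  power series entries and constant term \<open>I\<close>, and \<open>det G\<close> has constant
  term \<open>1\<close>.\<close>

lemma det_fls_lowest_coeff:
  fixes Q :: "'b::comm_ring_1 fls mat"
  assumes Q: "Q \<in> carrier_mat n n"
    and low: "\<And>i j m. i < n \<Longrightarrow> j < n \<Longrightarrow> m \<le> - S \<Longrightarrow> fls_nth (Q $$ (i,j)) m = 0"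
  defines "D \<equiv> det (fls_X_intpow (- S) \<cdot>\<^sub>m 1\<^sub>m n - Q)"
  shows "fls_nth D (- (int n * S)) = 1" and "m < - (int n * S) \<Longrightarrow> fls_nth D m = 0"
proof -
  define G where "G = mat n n (\<lambda>(i,j). fls_regpart ((if i = j then 1 else 0) - fls_shift (- S) (Q $$ (i,j))))"
  have G: "G \<in> carrier_mat n n" by (simp add: G_def)
  interpret F: comm_ring_hom "fps_to_fls :: 'b fps \<Rightarrow> 'b fls" by (rule fps_to_fls_hom)
  interpret N: comm_ring_hom "\<lambda>f :: 'b fps. fps_nth f 0" by (rule fps_nth_0_hom)
  have "fls_X_intpow (- S) \<cdot>\<^sub>m 1\<^sub>m n - Q = fls_X_intpow (- S) \<cdot>\<^sub>m map_mat fps_to_fls G"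
  proof (rule eq_matI)
    fix i j assume "i < dim_row (fls_X_intpow (- S) \<cdot>\<^sub>m map_mat fps_to_fls G)"
      "j < dim_col (fls_X_intpow (- S) \<cdot>\<^sub>m map_mat fps_to_fls G)"
    then have ij: "i < n" "j < n" using G by auto
    have "fls_nth (fls_shift (- S) (Q $$ (i,j))) m = 0" if "m \<le> 0" for m
      using low[OF ij] that by simp
    then have "fps_to_fls (G $$ (i,j)) = (if i = j then 1 else 0) - fls_shift (- S) (Q $$ (i,j))"
      using ij by (intro fls_eqI) (auto simp: G_def)
    then show "(fls_X_intpow (- S) \<cdot>\<^sub>m 1\<^sub>m n - Q) $$ (i,j)
        = (fls_X_intpow (- S) \<cdot>\<^sub>m map_mat fps_to_fls G) $$ (i,j)"
      using ij Q G by (auto simp: fls_shifted_times_simps right_diff_distrib)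
  qed (use Q G in auto)
  then have D: "D = fls_shift (int n * S) (fps_to_fls (det G))"
    using G fls_X_intpow_power[of "- S" n, where 'a = 'b]
      fls_X_intpow_times_conv_shift(1)[of "int n * - S" "fps_to_fls (det G)"]
    by (simp add: D_def)
  have "map_mat (\<lambda>f. fps_nth f 0) G = 1\<^sub>m n"
    using low by (intro eq_matI) (auto simp: G_def)
  then have "fps_nth (det G) 0 = 1"
    using N.hom_det[of G] by simp
  then show "fls_nth D (- (int n * S)) = 1" by (simp add: D)
  show "fls_nth D m = 0" if "m < - (int n * S)" using that by (simp add: D)
qed

text \<open>Over a domain lowest coefficients multiply, so those of \<open>E\<close> and
  \<open>P\<close> have product \<open>1\<close>.\<close>

lemma fls_factor_lowest_coeff_dvd:
  fixes E P :: "'b::idom fls"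
  assumes "fls_nth (E * P) N = 1" "\<And>m. m < N \<Longrightarrow> fls_nth (E * P) m = 0"
  shows "P \<noteq> 0" "fls_nth P (fls_subdegree P) dvd 1"
proof -
  from assms(1) have nz: "E \<noteq> 0" "P \<noteq> 0" by auto
  then show "P \<noteq> 0" by simp
  have "fls_subdegree (E * P) = N" using assms by (intro fls_subdegree_eqI) auto
  then have "fls_subdegree E + fls_subdegree P = N" using nz by simp
  then have "fls_nth E (fls_subdegree E) * fls_nth P (fls_subdegree P) = 1"
    using assms(1) fls_times_base[of E P] by simp
  then show "fls_nth P (fls_subdegree P) dvd 1" by (metis dvd_triv_right)
qed

text \<open>
  One half of expansivity: \<open>s = 1\<close> is the condition on \<open>deg\<^sup>-\<close> and \<open>s = -1\<close> the one on \<open>deg\<^sup>+\<close>. For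
  \<open>i = degree p\<close> and monic \<open>p\<close> the last clause repeats \<open>m < 0\<close>.
\<close>

definition constant_term_dominates :: "int \<Rightarrow> 'a::comm_ring_1 laurent poly \<Rightarrow> bool" where
  "constant_term_dominates s p \<longleftrightarrow> (\<exists>m<0. Poly_Mapping.lookup (coeff p 0) (s * m) \<noteq> 0 \<and>
     (\<forall>k<m. Poly_Mapping.lookup (coeff p 0) (s * k) = 0) \<and>
     (\<forall>i>0. \<forall>k\<le>m. Poly_Mapping.lookup (coeff p i) (s * k) = 0))"

text \<open>After \<open>swap_vars s\<close>, the relation \<open>eq\<close> gives a multiple of
  \<open>\<chi>\<close> with lowest coefficient \<open>1\<close>. The lowest coefficient of
  \<open>\<chi>\<close> is thus a unit of \<open>k[t]\<close>, hence a nonzero constant: at that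
  exponent only the constant term of \<open>\<chi>\<close> contributes.\<close>

lemma constant_term_dominates_char_poly:
  fixes A :: "'a::field laurent mat"
  assumes A: "A \<in> carrier_mat n n" and n: "n > 0" and s: "s * s = 1"
    and Q: "Q \<in> carrier_mat n n" and B: "B \<in> carrier_mat n n"
    and eq: "[:lX (- (s * S)):] \<cdot>\<^sub>m 1\<^sub>m n - Q = B * char_poly_matrix A"
    and low: "\<And>i j k m. i < n \<Longrightarrow> j < n \<Longrightarrow> m \<le> - S \<Longrightarrow>
      Poly_Mapping.lookup (coeff (Q $$ (i,j)) k) (s * m) = 0"
  shows "constant_term_dominates s (char_poly A)"
proof -
  define \<chi> where "\<chi> = char_poly A"
  interpret V: comm_ring_hom "swap_vars s :: 'a laurent poly \<Rightarrow> _" by (rule swap_vars_hom[OF s])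
  have ss: "s * m = - (s * S) \<longleftrightarrow> m = - S" for m
    using s by (metis mult.assoc mult_1 mult_minus_right)
  have X: "swap_vars s [:lX (- (s * S)) :: 'a laurent:] = fls_X_intpow (- S)"
  proof (intro fls_eqI poly_eqI)
    fix m i
    show "coeff (fls_nth (swap_vars s [:lX (- (s * S)) :: 'a laurent:]) m) i
        = coeff (fls_nth (fls_X_intpow (- S)) m) i"
    proof (cases "m = - S")
      case True
      then show ?thesis by (cases i) (simp_all add: coeff_swap_vars[OF s] lookup_single)
    next
      case False
      then have "- (s * S) \<noteq> s * m" "m + S \<noteq> 0" using ss[of m] by auto
      then show ?thesis
        by (cases i) (simp_all add: coeff_swap_vars[OF s] lookup_single)
    qed
  qed
  have cA: "char_poly_matrix A \<in> carrier_mat n n" using A by simp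
  have "det B * \<chi> = det ([:lX (- (s * S)):] \<cdot>\<^sub>m 1\<^sub>m n - Q)"
    unfolding eq det_mult[OF B cA] by (simp add: \<chi>_def char_poly_def)
  then have "swap_vars s (det B) * swap_vars s \<chi> = swap_vars s (det ([:lX (- (s * S)):] \<cdot>\<^sub>m 1\<^sub>m n - Q))"
    by (metis V.hom_mult)
  also have "\<dots> = det (map_mat (swap_vars s) ([:lX (- (s * S)):] \<cdot>\<^sub>m 1\<^sub>m n - Q))"
    by (rule V.hom_det[symmetric])
  also have "map_mat (swap_vars s) ([:lX (- (s * S)):] \<cdot>\<^sub>m 1\<^sub>m n - Q)
      = fls_X_intpow (- S) \<cdot>\<^sub>m 1\<^sub>m n - map_mat (swap_vars s) Q"
    using Q by (intro eq_matI) (auto simp: V.hom_minus V.hom_mult X)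
  finally have fac: "swap_vars s (det B) * swap_vars s \<chi> = det (fls_X_intpow (- S) \<cdot>\<^sub>m 1\<^sub>m n - map_mat (swap_vars s) Q)" .
  have Q': "map_mat (swap_vars s) Q \<in> carrier_mat n n" using Q by simp
  have low': "fls_nth (map_mat (swap_vars s) Q $$ (i,j)) m = 0" if "i < n" "j < n" "m \<le> - S" for i j m
    using that Q by (intro poly_eqI) (auto simp: coeff_swap_vars[OF s] low)
  have D: "fls_nth (swap_vars s (det B) * swap_vars s \<chi>) (- (int n * S)) = 1"
    "\<And>m. m < - (int n * S) \<Longrightarrow> fls_nth (swap_vars s (det B) * swap_vars s \<chi>) m = 0"
    unfolding fac using det_fls_lowest_coeff[OF Q', of S] low' by blast+
  define m where "m = fls_subdegree (swap_vars s \<chi>)"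
  have nz: "swap_vars s \<chi> \<noteq> 0" and u: "fls_nth (swap_vars s \<chi>) m dvd 1"
    unfolding m_def using fls_factor_lowest_coeff_dvd[OF D] by auto
  have deg: "degree (fls_nth (swap_vars s \<chi>) m) = 0" using u by (simp add: poly_dvd_1)
  have "fls_nth (swap_vars s \<chi>) m \<noteq> 0" using nz by (simp add: m_def)
  then have c0: "coeff (fls_nth (swap_vars s \<chi>) m) 0 \<noteq> 0"
    using deg by (metis degree_0_id pCons_0_0)
  have less: "Poly_Mapping.lookup (coeff \<chi> i) (s * k) = 0" if "k < m" for k i
    unfolding coeff_swap_vars[OF s, symmetric] using that by (simp add: m_def)
  have eqm: "Poly_Mapping.lookup (coeff \<chi> i) (s * m) = 0" if "i > 0" for i
    unfolding coeff_swap_vars[OF s, symmetric] using that deg by (simp add: coeff_eq_0)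
  have monic: "coeff \<chi> n = 1" using degree_monic_char_poly[OF A] by (simp add: \<chi>_def)
  \<comment> \<open>The leading term \<open>t^n\<close> has coefficient \<open>1\<close> at exponent
    \<open>0\<close> of \<open>X\<close>, so \<open>m \<le> 0\<close>; and \<open>m = 0\<close> is
    excluded because the coefficient at \<open>m\<close> has degree \<open>0 < n\<close> in
    \<open>t\<close>.\<close>
  have "m < 0"
  proof (rule ccontr)
    assume "\<not> m < 0"
    then have "Poly_Mapping.lookup (coeff \<chi> n) (s * 0) = 0"
      using less[of 0 n] eqm[OF n] by (cases "m = 0") auto
    then show False by (simp add: monic)
  qed
  then show ?thesis
    unfolding constant_term_dominates_def \<chi>_def[symmetric]
    using c0 less eqm by (intro exI[of _ m]) (auto simp: coeff_swap_vars[OF s] order.order_iff_strict)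
qed

text \<open>The induction uses \<open>t^(i+1) - A^(i+1) = t (t^i - A^i) + A^i (t - A)\<close>. With
  \<open>t I - A\<close> as the right factor, row \<open>k\<close> of \<open>A^i\<close> is
  congruent to \<open>t^i e_k\<close> modulo the rows of \<open>t I - A\<close>.\<close>

lemma monom_minus_power_dvd_char_poly_matrix:
  fixes A :: "'a::comm_ring_1 mat"
  assumes A: "A \<in> carrier_mat n n"
  shows "\<exists>G \<in> carrier_mat n n. monom 1 i \<cdot>\<^sub>m 1\<^sub>m n - map_mat (\<lambda>a. [:a:]) (A ^\<^sub>m i) = G * char_poly_matrix A"
proof (induction i)
  case 0
  show ?case
    using A left_mult_zero_mat[of "char_poly_matrix A" n n n]
    by (intro bexI[of _ "0\<^sub>m n n"]) (auto simp: one_pCons intro!: eq_matI)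
next
  case (Suc i)
  then obtain G where G: "G \<in> carrier_mat n n"
    and eq: "monom 1 i \<cdot>\<^sub>m 1\<^sub>m n - map_mat (\<lambda>a. [:a:]) (A ^\<^sub>m i) = G * char_poly_matrix A" by blast
  let ?C = "map_mat (\<lambda>a. [:a:]) :: 'a mat \<Rightarrow> _" and ?c = "char_poly_matrix A" and ?T = "[:0, 1:] :: 'a poly"
  interpret pC: comm_ring_hom "\<lambda>a :: 'a. [:a:]" by (rule pCons_hom)
  have Ai: "A ^\<^sub>m i \<in> carrier_mat n n" using A by simp
  have c: "?c \<in> carrier_mat n n" using A by simp
  have c_alt: "?c = ?T \<cdot>\<^sub>m 1\<^sub>m n - ?C A"
    using A by (intro eq_matI) (auto simp: char_poly_matrix_def)
  have "?C (A ^\<^sub>m i) * ?c = ?C (A ^\<^sub>m i) * (?T \<cdot>\<^sub>m 1\<^sub>m n) - ?C (A ^\<^sub>m i) * ?C A"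
    unfolding c_alt using A Ai by (intro mult_minus_distrib_mat) auto
  also have "?C (A ^\<^sub>m i) * (?T \<cdot>\<^sub>m 1\<^sub>m n) = ?T \<cdot>\<^sub>m ?C (A ^\<^sub>m i)"
    using Ai by (subst mult_smult_distrib[of _ n n _ n]) auto
  also have "?C (A ^\<^sub>m i) * ?C A = ?C (A ^\<^sub>m Suc i)"
    using pC.mat_hom_mult[OF Ai A] by simp
  finally have 1: "?C (A ^\<^sub>m i) * ?c = ?T \<cdot>\<^sub>m ?C (A ^\<^sub>m i) - ?C (A ^\<^sub>m Suc i)" .
  have "(?T \<cdot>\<^sub>m G + ?C (A ^\<^sub>m i)) * ?c = (?T \<cdot>\<^sub>m G) * ?c + ?C (A ^\<^sub>m i) * ?c"
    using G Ai c by (intro add_mult_distrib_mat) auto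
  also have "(?T \<cdot>\<^sub>m G) * ?c = ?T \<cdot>\<^sub>m (monom 1 i \<cdot>\<^sub>m 1\<^sub>m n - ?C (A ^\<^sub>m i))"
    unfolding eq using G c by (intro mult_smult_assoc_mat) auto
  also note 1
  also have "?T \<cdot>\<^sub>m (monom 1 i \<cdot>\<^sub>m 1\<^sub>m n - ?C (A ^\<^sub>m i)) + (?T \<cdot>\<^sub>m ?C (A ^\<^sub>m i) - ?C (A ^\<^sub>m Suc i))
     = monom 1 (Suc i) \<cdot>\<^sub>m 1\<^sub>m n - ?C (A ^\<^sub>m Suc i)"
    using A Ai by (intro eq_matI) (auto simp: monom_Suc)
  finally show ?case
    using G Ai by (intro bexI[of _ "?T \<cdot>\<^sub>m G + ?C (A ^\<^sub>m i)"]) auto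
qed

text \<open>Comparing powers of \<open>t\<close> in \<open>(t I - A) B = \<chi> I\<close>, with
  \<open>B\<close> the adjugate, expresses the coefficients of \<open>\<chi>\<close> through the
  matrices \<open>b i\<close>; multiplied by \<open>A^i\<close>, they telescope.\<close>

lemma cayley_hamilton_entry:
  fixes A :: "'a::comm_ring_1 mat"
  assumes A: "A \<in> carrier_mat n n" and kl: "k < n" "l < n"
  shows "(\<Sum>i\<le>n. coeff (char_poly A) i * (A ^\<^sub>m i) $$ (k,l)) = 0"
proof -
  define \<chi> where "\<chi> = char_poly A"
  define B where "B = adj_mat (char_poly_matrix A)"
  define b where "b i = map_mat (\<lambda>p. coeff p i) B" for i
  have c: "char_poly_matrix A \<in> carrier_mat n n" using A by simp
  have B: "B \<in> carrier_mat n n" and cB: "char_poly_matrix A * B = \<chi> \<cdot>\<^sub>m 1\<^sub>m n"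
    using adj_mat[OF c] by (simp_all add: B_def \<chi>_def char_poly_def)
  have b: "b i \<in> carrier_mat n n" for i using B by (simp add: b_def)
  have entry: "[:0, 1:] * B $$ (k,l) - (\<Sum>m<n. [:A $$ (k,m):] * B $$ (m,l)) = (if k = l then \<chi> else 0)"
    if "k < n" "l < n" for k l
  proof -
    have "(if k = l then \<chi> else 0) = (char_poly_matrix A * B) $$ (k,l)"
      unfolding cB using that by simp
    also have "\<dots> = (\<Sum>m<n. ((if k = m then [:0,1:] else 0) - [:A $$ (k,m):]) * B $$ (m,l))"
      using A B that c unfolding char_poly_matrix_def
      by (auto simp: scalar_prod_def lessThan_atLeast0 intro!: sum.cong)
    also have "\<dots> = (\<Sum>m<n. (if k = m then [:0,1:] * B $$ (m,l) else 0)) - (\<Sum>m<n. [:A $$ (k,m):] * B $$ (m,l))"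
      unfolding sum_subtractf[symmetric] by (intro sum.cong) (auto simp: left_diff_distrib)
    finally show ?thesis using that by simp
  qed
  have b0: "- (A * b 0) $$ (k,l) = (if k = l then coeff \<chi> 0 else 0)" if "k < n" "l < n" for k l
    using arg_cong[OF entry[OF that], of "\<lambda>p. coeff p 0"] that A B
    by (auto simp: b_def scalar_prod_def coeff_sum coeff_mult lessThan_atLeast0 split: if_splits)
  have bS: "(A * b (Suc i)) $$ (k,l) = b i $$ (k,l) - (if k = l then coeff \<chi> (Suc i) else 0)"
    if "k < n" "l < n" for k l i
    using arg_cong[OF entry[OF that], of "\<lambda>p. coeff p (Suc i)"] that A B
    by (auto simp: b_def scalar_prod_def coeff_sum lessThan_atLeast0 algebra_simps)
  have b0': "(A * b 0) $$ (k,l) = - (if k = l then coeff \<chi> 0 else 0)" if "k < n" "l < n" for k l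
    using b0[OF that] by (metis minus_minus)
  have b0'': "A * b 0 = - (coeff \<chi> 0 \<cdot>\<^sub>m 1\<^sub>m n)"
    using A b by (intro eq_matI) (auto simp del: index_mult_mat(1) simp: b0')
  have bS': "A * b (Suc i) = b i - (coeff \<chi> (Suc i) \<cdot>\<^sub>m 1\<^sub>m n)" for i
    using A b[of "Suc i"] b[of i] by (intro eq_matI) (auto simp del: index_mult_mat(1) simp: bS)
  have tele: "(\<Sum>i\<le>N. coeff \<chi> i * (A ^\<^sub>m i) $$ (k,l)) = - (A ^\<^sub>m Suc N * b N) $$ (k,l)" for N
  proof (induction N)
    case 0
    show ?case using A kl b[of 0] by (simp add: b0'' del: index_mult_mat(1)) 
  next
    case (Suc N)
    have P: "A ^\<^sub>m Suc N \<in> carrier_mat n n" using A by (rule pow_carrier_mat)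
    have "A ^\<^sub>m Suc (Suc N) * b (Suc N) = A ^\<^sub>m Suc N * (A * b (Suc N))"
      unfolding pow_mat.simps(2)[of A "Suc N"] by (rule assoc_mult_mat[OF P A b])
    also have "\<dots> = A ^\<^sub>m Suc N * b N - A ^\<^sub>m Suc N * (coeff \<chi> (Suc N) \<cdot>\<^sub>m 1\<^sub>m n)"
      unfolding bS' using P b by (intro mult_minus_distrib_mat) auto
    also have "A ^\<^sub>m Suc N * (coeff \<chi> (Suc N) \<cdot>\<^sub>m 1\<^sub>m n) = coeff \<chi> (Suc N) \<cdot>\<^sub>m A ^\<^sub>m Suc N"
      using P by (subst mult_smult_distrib[of _ n n _ n]) auto
    finally have "(A ^\<^sub>m Suc (Suc N) * b (Suc N)) $$ (k,l)
        = (A ^\<^sub>m Suc N * b N) $$ (k,l) - coeff \<chi> (Suc N) * (A ^\<^sub>m Suc N) $$ (k,l)"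
      using carrier_matD[OF P] carrier_matD[OF b[of N]] carrier_matD[OF A] kl
      by (simp del: index_mult_mat(1) pow_mat.simps)
    then show ?case using Suc by (simp del: index_mult_mat(1) pow_mat.simps)
  qed
  \<comment> \<open>At least \<open>n\<close> and larger than the degree of every entry of
    \<open>B\<close>: the sum then covers all of \<open>\<chi>\<close>, and the boundary term
    contains \<open>b N = 0\<close>.\<close>
  define N where "N = Max (insert n ((\<lambda>(i,j). Suc (degree (B $$ (i,j)))) ` ({..<n} \<times> {..<n})))"
  have "b N = 0\<^sub>m n n"
  proof (rule eq_matI)
    fix i j assume ij: "i < dim_row (0\<^sub>m n n)" "j < dim_col (0\<^sub>m n n)"
    then have "Suc (degree (B $$ (i,j))) \<le> N" unfolding N_def by (intro Max_ge) force+
    then show "b N $$ (i,j) = 0\<^sub>m n n $$ (i,j)" using ij B by (simp add: b_def coeff_eq_0)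
  qed (use b[of N] in auto)
  then have "(\<Sum>i\<le>N. coeff \<chi> i * (A ^\<^sub>m i) $$ (k,l)) = 0"
    unfolding tele using kl by (simp add: right_mult_zero_mat[OF pow_carrier_mat[OF A, of "Suc N"]] del: pow_mat.simps index_mult_mat(1))
  moreover have "n \<le> N" unfolding N_def by (intro Max_ge) auto
  moreover have "coeff \<chi> i = 0" if "i > n" for i
    using degree_monic_char_poly[OF A] that by (simp add: \<chi>_def coeff_eq_0)
  ultimately show ?thesis
    unfolding \<chi>_def[symmetric]
    by (subst sum.mono_neutral_left[of "{..N}"]) auto
qed

section \<open>Automata and linear functionals\<close>

lemma pow_mat_Suc_left:
  fixes A :: "'a::semiring_1 mat"
  assumes A: "A \<in> carrier_mat n n"
  shows "A ^\<^sub>m Suc t = A * A ^\<^sub>m t"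
proof (induction t)
  case (Suc t)
  have "A ^\<^sub>m Suc (Suc t) = A * A ^\<^sub>m t * A" using Suc by simp
  also have "\<dots> = A * (A ^\<^sub>m t * A)"
    using A by (intro assoc_mult_mat[of _ n n _ n]) auto
  finally show ?case by simp
qed (use A in auto)

definition laurent_matrix :: "nat \<Rightarrow> nat \<Rightarrow> (int \<Rightarrow> 'a::comm_ring_1 mat) \<Rightarrow> 'a laurent mat" where
  "laurent_matrix n r Aj = mat n n (\<lambda>(k,l). \<Sum>j\<in>{-int r..int r}. Poly_Mapping.single (- j) (Aj j $$ (k,l)))"

lemma laurent_matrix_carrier [simp]: "laurent_matrix n r Aj \<in> carrier_mat n n"
  by (simp add: laurent_matrix_def)

lemma id_hom: "comm_ring_hom (\<lambda>a :: 'a::comm_ring_1. a)"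
  by unfold_locales auto

lemma lca_matrix_eq_map_laurent:
  "lca_matrix n r Aj = map_mat (laurent_to_fls 1 (\<lambda>a. a)) (laurent_matrix n r Aj)"
proof -
  interpret i: comm_ring_hom "\<lambda>a :: 'a. a" by (rule id_hom)
  interpret h: comm_ring_hom "laurent_to_fls 1 (\<lambda>a :: 'a. a)" by (rule i.laurent_to_fls_hom) simp
  show ?thesis
    unfolding lca_matrix_def laurent_matrix_def
    by (intro eq_matI)
      (auto simp: h.hom_sum i.laurent_to_fls_single fls_shifted_times_simps intro!: sum.cong)
qed

section \<open>Linear functionals on Laurent polynomials\<close>

definition laurent_functional :: "('a::comm_ring_1 laurent \<Rightarrow> 'a) \<Rightarrow> bool" where
  "laurent_functional \<phi> \<longleftrightarrow> (\<forall>f g. \<phi> (f + g) = \<phi> f + \<phi> g) \<and> (\<forall>a f. \<phi> (lC a * f) = a * \<phi> f)"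

lemma laurent_functional_sum:
  assumes "laurent_functional \<phi>"
  shows "\<phi> (\<Sum>i\<in>I. f i) = (\<Sum>i\<in>I. \<phi> (f i))"
proof -
  have "\<phi> (0 + 0) = \<phi> 0 + \<phi> 0" using assms unfolding laurent_functional_def by blast
  then have "\<phi> 0 = 0" by simp
  then show ?thesis
    using assms by (induction I rule: infinite_finite_induct) (auto simp: laurent_functional_def)
qed

lemma laurent_functional_single:
  assumes "laurent_functional \<phi>"
  shows "\<phi> (Poly_Mapping.single k a * f) = a * \<phi> (lX k * f)"
proof -
  have "Poly_Mapping.single k a * f = lC a * (lX k * f)"
    by (simp add: mult_single mult.assoc[symmetric])
  then show ?thesis using assms by (simp add: laurent_functional_def)
qed

text \<open>
  The exponent is negated because \<open>X\<^sup>j\<close> acts on configurations as the shift \<open>(X\<^sup>j c)\<^sub>x = c\<^sub>x\<^sub>-\<^sub>j\<close>.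
\<close>

definition pairing :: "(int \<Rightarrow> 'a::comm_ring_1) \<Rightarrow> 'a laurent \<Rightarrow> 'a" where
  "pairing y f = (\<Sum>j\<in>Poly_Mapping.keys f. Poly_Mapping.lookup f j * y (- j))"

lemma pairing_superset:
  assumes "finite S" "Poly_Mapping.keys f \<subseteq> S"
  shows "pairing y f = (\<Sum>j\<in>S. Poly_Mapping.lookup f j * y (- j))"
  unfolding pairing_def using assms by (intro sum.mono_neutral_left) (auto simp: in_keys_iff)

lemma lookup_lC_mult: "Poly_Mapping.lookup (lC a * f) j = a * Poly_Mapping.lookup f j"
  unfolding mult_map_scale_conv_mult[symmetric] by (simp add: Poly_Mapping.map.rep_eq when_def)

lemma laurent_functional_pairing: "laurent_functional (pairing y)"
  unfolding laurent_functional_def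
proof (intro conjI allI)
  fix f g :: "'a laurent"
  let ?S = "Poly_Mapping.keys f \<union> Poly_Mapping.keys g"
  show "pairing y (f + g) = pairing y f + pairing y g"
    using keys_add[of f g]
    by (subst (1 2 3) pairing_superset[of ?S]) (auto simp: lookup_add distrib_right sum.distrib)
next
  fix a and f :: "'a laurent"
  have "Poly_Mapping.keys (lC a * f) \<subseteq> Poly_Mapping.keys f"
    by (auto simp: in_keys_iff lookup_lC_mult)
  then show "pairing y (lC a * f) = a * pairing y f"
    by (subst (1 2) pairing_superset[of "Poly_Mapping.keys f"])
      (auto simp: lookup_lC_mult sum_distrib_left mult.assoc)
qed

lemma pairing_lX [simp]: "pairing y (lX (- x)) = y x"
  by (cases "(1::'a) = 0") (auto simp: pairing_def) 

lemma pairing_diff: "pairing (\<lambda>x. y x - z x) f = pairing y f - pairing z f"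
  by (simp add: pairing_def right_diff_distrib sum_subtractf)

section \<open>The metric and windows of cells\<close>

lemma config_dist_ge:
  assumes "c j \<noteq> c' j" "nat \<bar>j\<bar> \<le> M"
  shows "config_dist c c' \<ge> (1/2) ^ M"
proof -
  have "(LEAST m::nat. \<exists>j. nat \<bar>j\<bar> = m \<and> c j \<noteq> c' j) \<le> nat \<bar>j\<bar>"
    using assms by (intro Least_le) auto
  then show ?thesis
    using assms by (auto simp: config_dist_def intro!: power_decreasing)
qed

lemma config_dist_le:
  assumes "\<And>j. \<bar>j\<bar> \<le> int M \<Longrightarrow> c j = c' j"
  shows "config_dist c c' \<le> (1/2) ^ M"
proof (cases "c = c'")
  case False
  then have "\<exists>m. \<exists>j. nat \<bar>j\<bar> = m \<and> c j \<noteq> c' j" by auto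
  from LeastI_ex[OF this] obtain j where j: "nat \<bar>j\<bar> = (LEAST m::nat. \<exists>j. nat \<bar>j\<bar> = m \<and> c j \<noteq> c' j)" "c j \<noteq> c' j"
    by auto
  have "M \<le> nat \<bar>j\<bar>" using assms[of j] j(2) by linarith
  then show ?thesis using False j(1) by (auto simp: config_dist_def intro!: power_decreasing)
qed (simp add: config_dist_def)

locale lca_rule =
  fixes n r :: nat and Aj :: "int \<Rightarrow> 'a::field mat"
  assumes Aj: "\<And>j. j \<in> {-int r..int r} \<Longrightarrow> Aj j \<in> carrier_mat n n"
begin

abbreviation "F \<equiv> lca n r Aj"
abbreviation "A \<equiv> laurent_matrix n r Aj"

lemma lca_power_config: "is_config n c \<Longrightarrow> is_config n ((F ^^ t) c)"
  by (cases t) (auto simp: is_config_def lca_def)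

text \<open>Each application of the rule contributes one factor \<open>A\<close>. The functionals
  stay abstract because two kinds are used: \<open>pairing\<close> with a given configuration, and a
  functional obtained by separation from a subspace.\<close>

lemma lca_power_functional:
  assumes c: "is_config n c" and \<phi>: "\<And>l. l < n \<Longrightarrow> laurent_functional (\<phi> l)"
    and c\<phi>: "\<And>x l. l < n \<Longrightarrow> c x $ l = \<phi> l (lX (- x))"
    and k: "k < n"
  shows "(F ^^ t) c x $ k = (\<Sum>l<n. \<phi> l (lX (- x) * (A ^\<^sub>m t) $$ (k,l)))"
  using k
proof (induction t arbitrary: x k)
  case 0
  \<comment> \<open>The sum over \<open>{}\<close> yields \<open>\<phi> l 0 = 0\<close>, which
    removes the off-diagonal entries.\<close>
  have "(\<Sum>l<n. \<phi> l (lX (- x) * (A ^\<^sub>m 0) $$ (k,l))) = (\<Sum>l<n. if l = k then \<phi> k (lX (- x)) else 0)"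
    using 0 laurent_functional_sum[OF \<phi>, of _ _ "{}"] by (intro sum.cong) (auto simp: laurent_matrix_def)
  then show ?case using 0 c\<phi> by simp
next
  case (Suc t)
  let ?c = "(F ^^ t) c" and ?P = "A ^\<^sub>m t"
  have P: "?P \<in> carrier_mat n n" by simp
  have dim: "dim_vec (?c y) = n" for y using lca_power_config[OF c, of t] by (simp add: is_config_def)
  have "(F ^^ Suc t) c x $ k = (\<Sum>j\<in>{-int r..int r}. (Aj j *\<^sub>v ?c (x + j)) $ k)"
    using Suc.prems by (simp add: lca_def)
  also have "\<dots> = (\<Sum>j\<in>{-int r..int r}. \<Sum>m<n. Aj j $$ (k,m) * ?c (x + j) $ m)"
  proof (intro sum.cong refl)
    fix j assume "j \<in> {-int r..int r}"
    from carrier_matD[OF Aj[OF this]] show "(Aj j *\<^sub>v ?c (x + j)) $ k = (\<Sum>m<n. Aj j $$ (k,m) * ?c (x + j) $ m)"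
      using Suc.prems dim by (simp add: scalar_prod_def lessThan_atLeast0)
  qed
  also have "\<dots> = (\<Sum>j\<in>{-int r..int r}. \<Sum>m<n. \<Sum>l<n. Aj j $$ (k,m) * \<phi> l (lX (- (x + j)) * ?P $$ (m,l)))"
    by (simp add: Suc.IH sum_distrib_left)
  also have "\<dots> = (\<Sum>l<n. \<Sum>m<n. \<Sum>j\<in>{-int r..int r}. Aj j $$ (k,m) * \<phi> l (lX (- (x + j)) * ?P $$ (m,l)))"
    by (subst sum.swap, subst sum.swap, subst (2) sum.swap, rule refl)
  also have "\<dots> = (\<Sum>l<n. \<phi> l (lX (- x) * (A ^\<^sub>m Suc t) $$ (k,l)))"
  proof (intro sum.cong refl)
    fix l assume l: "l \<in> {..<n}"
    then have f: "laurent_functional (\<phi> l)" using \<phi> by simp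
    \<comment> \<open>The outermost application of \<open>F\<close> supplies the left factor, so the
      power is split as \<open>A * A^t\<close>.\<close>
    have "lX (- x) * (A ^\<^sub>m Suc t) $$ (k,l) = (\<Sum>m<n. lX (- x) * (A $$ (k,m) * ?P $$ (m,l)))"
      unfolding pow_mat_Suc_left[OF laurent_matrix_carrier] using Suc.prems l carrier_matD[OF P]
      by (simp add: scalar_prod_def lessThan_atLeast0 sum_distrib_left laurent_matrix_def)
    also have "\<dots> = (\<Sum>m<n. \<Sum>j\<in>{-int r..int r}. Poly_Mapping.single (- (x + j)) (Aj j $$ (k,m)) * ?P $$ (m,l))"
    proof (intro sum.cong refl)
      fix m assume "m \<in> {..<n}"
      then have "lX (- x) * A $$ (k,m) = (\<Sum>j\<in>{-int r..int r}. Poly_Mapping.single (- (x + j)) (Aj j $$ (k,m)))"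
        using Suc.prems by (simp add: laurent_matrix_def sum_distrib_left mult_single)
      then show "lX (- x) * (A $$ (k,m) * ?P $$ (m,l))
        = (\<Sum>j\<in>{-int r..int r}. Poly_Mapping.single (- (x + j)) (Aj j $$ (k,m)) * ?P $$ (m,l))"
        by (simp only: mult.assoc[symmetric] sum_distrib_right)
    qed
    finally show "(\<Sum>m<n. \<Sum>j\<in>{-int r..int r}. Aj j $$ (k,m) * \<phi> l (lX (- (x + j)) * ?P $$ (m,l)))
       = \<phi> l (lX (- x) * (A ^\<^sub>m Suc t) $$ (k,l))"
      by (simp only: laurent_functional_sum[OF f])
        (intro sum.cong refl laurent_functional_single[OF f, symmetric])
  qed
  finally show ?case .
qed

lemma lca_power_pairing:
  assumes "is_config n c" "k < n"
  shows "(F ^^ t) c x $ k = (\<Sum>l<n. pairing (\<lambda>y. c y $ l) (lX (- x) * (A ^\<^sub>m t) $$ (k,l)))"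
  using assms by (intro lca_power_functional) (auto intro: laurent_functional_pairing)

lemma lca_power_diff:
  assumes c: "is_config n c" and c': "is_config n c'"
  shows "(F ^^ t) (\<lambda>x. c x - c' x) x = (F ^^ t) c x - (F ^^ t) c' x"
proof (rule eq_vecI)
  have d: "is_config n (\<lambda>x. c x - c' x)" using c c' by (simp add: is_config_def)
  note dims = lca_power_config[OF c, of t] lca_power_config[OF c', of t] lca_power_config[OF d, of t]
  show "dim_vec ((F ^^ t) (\<lambda>x. c x - c' x) x) = dim_vec ((F ^^ t) c x - (F ^^ t) c' x)"
    using dims by (simp add: is_config_def)
  fix k assume "k < dim_vec ((F ^^ t) c x - (F ^^ t) c' x)"
  then have k: "k < n" using dims by (simp add: is_config_def)
  have "pairing (\<lambda>y. (c y - c' y) $ l) f = pairing (\<lambda>y. c y $ l) f - pairing (\<lambda>y. c' y $ l) f"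
    if "l < n" for l f
    using that c c' by (simp add: is_config_def pairing_diff[symmetric])
  then show "(F ^^ t) (\<lambda>x. c x - c' x) x $ k = ((F ^^ t) c x - (F ^^ t) c' x) $ k"
    using k dims
    by (simp add: lca_power_pairing[OF d k] lca_power_pairing[OF c k] lca_power_pairing[OF c' k]
      sum_subtractf is_config_def)
qed

text \<open>By linearity a pair of configurations can be replaced by its difference and zero. A
  distance of at least \<open>(1/2)^M\<close> means a difference at some cell of
  \<open>[-M, M]\<close>.\<close>

lemma positively_expansive_iff_window:
  "positively_expansive n F \<longleftrightarrow>
    (\<exists>M::nat. \<forall>c. is_config n c \<longrightarrow> (\<forall>t x. \<bar>x\<bar> \<le> int M \<longrightarrow> (F ^^ t) c x = 0\<^sub>v n) \<longrightarrow> c = (\<lambda>_. 0\<^sub>v n))"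
    (is "?L \<longleftrightarrow> (\<exists>M. ?W M)")
proof
  let ?z = "\<lambda>_::int. 0\<^sub>v n :: 'a vec"
  have z: "is_config n ?z" by (simp add: is_config_def)
  have Fz: "(F ^^ t) ?z x = 0\<^sub>v n" for t x
  proof -
    have "(F ^^ t) ?z x \<in> carrier_vec n"
      using lca_power_config[OF z, of t] by (intro carrier_vecI) (simp add: is_config_def)
    then show ?thesis using lca_power_diff[OF z z, of t x] by simp
  qed
  assume ?L
  then obtain e :: real where e: "e > 0" and ex: "\<And>c c'. is_config n c \<Longrightarrow> is_config n c' \<Longrightarrow> c \<noteq> c' \<Longrightarrow>
      \<exists>l::nat. config_dist ((F ^^ l) c) ((F ^^ l) c') \<ge> e"
    unfolding positively_expansive_def by blast
  obtain M where M: "(1/2) ^ M < e" using real_arch_pow_inv[OF e, of "1/2"] by auto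
  have "?W M"
  proof (intro allI impI)
    fix c assume c: "is_config n c" and w: "\<forall>t x. \<bar>x\<bar> \<le> int M \<longrightarrow> (F ^^ t) c x = 0\<^sub>v n"
    show "c = ?z"
    proof (rule ccontr)
      assume "c \<noteq> ?z"
      from ex[OF c z this] obtain l where "config_dist ((F ^^ l) c) ((F ^^ l) ?z) \<ge> e" by blast
      moreover have "config_dist ((F ^^ l) c) ((F ^^ l) ?z) \<le> (1/2) ^ M"
        using w Fz by (intro config_dist_le) auto
      ultimately show False using M by linarith
    qed
  qed
  then show "\<exists>M. ?W M" ..
next
  assume "\<exists>M. ?W M"
  then obtain M where W: "?W M" ..
  show ?L
    unfolding positively_expansive_def
  proof (intro exI[of _ "(1/2) ^ M"] conjI allI impI)
    fix c c' :: "int \<Rightarrow> 'a vec" assume c: "is_config n c" and c': "is_config n c'" and ne: "c \<noteq> c'"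
    let ?d = "\<lambda>x. c x - c' x"
    have d: "is_config n ?d" using c c' by (simp add: is_config_def)
    obtain x where "c x \<noteq> c' x" using ne by auto
    then have "?d x \<noteq> 0\<^sub>v n"
      using c c' by (auto simp: is_config_def vec_eq_iff)
    then have "?d \<noteq> (\<lambda>_. 0\<^sub>v n)" by metis
    then obtain t x where x: "\<bar>x\<bar> \<le> int M" and "(F ^^ t) ?d x \<noteq> 0\<^sub>v n" using W d by blast
    then have "(F ^^ t) c x - (F ^^ t) c' x \<noteq> 0\<^sub>v n" by (simp add: lca_power_diff[OF c c'])
    then have "(F ^^ t) c x \<noteq> (F ^^ t) c' x"
      using lca_power_config[OF c', of t] by (auto simp: is_config_def)
    then show "\<exists>l. config_dist ((F ^^ l) c) ((F ^^ l) c') \<ge> (1/2) ^ M"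
      using x by (intro exI[of _ t] config_dist_ge[of _ x]) auto
  qed auto
qed

end

section \<open>Positive expansivity implies expansivity\<close>

lemma laurent_vector_space:
  "vector_space (\<lambda>a (w :: 'a::field laurent poly). smult (lC a) w)"
  by unfold_locales (simp_all add: single_add smult_add_left smult_add_right mult_single)

lemma field_vector_space: "vector_space ((*) :: 'a::field \<Rightarrow> 'a \<Rightarrow> 'a)"
  by unfold_locales (simp_all add: algebra_simps)

text \<open>A basis of the span of \<open>S\<close> stays independent when \<open>v\<close> is
  added, so a linear map may be prescribed as \<open>1\<close> at \<open>v\<close> and
  \<open>0\<close> on the basis.\<close>

lemma separating_functional:
  fixes v :: "'a::field laurent poly"
  assumes "v \<notin> module.span (\<lambda>a w. smult (lC a) w) S"
  obtains \<phi> where "\<And>u w. \<phi> (u + w) = \<phi> u + \<phi> w" "\<And>a w. \<phi> (smult (lC a) w) = a * \<phi> w"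
    "\<And>w. w \<in> S \<Longrightarrow> \<phi> w = 0" "\<phi> v = 1"
proof -
  interpret V: vector_space "\<lambda>a (w :: 'a laurent poly). smult (lC a) w" by (rule laurent_vector_space)
  interpret K: vector_space "(*) :: 'a \<Rightarrow> 'a \<Rightarrow> 'a" by (rule field_vector_space)
  interpret P: vector_space_pair "\<lambda>a (w :: 'a laurent poly). smult (lC a) w" "(*) :: 'a \<Rightarrow> 'a \<Rightarrow> 'a" ..
  obtain B where B: "B \<subseteq> S" "V.independent B" "S \<subseteq> V.span B" by (rule V.maximal_independent_subset)
  have v: "v \<notin> V.span B" using assms V.span_mono[OF B(1)] by blast
  then have "V.independent (insert v B)" using B(2) by (rule V.independent_insertI)
  from P.linear_independent_extend[OF this, of "\<lambda>w. if w = v then 1 else 0"]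
  obtain \<phi> where lin: "Vector_Spaces.linear (\<lambda>a w. smult (lC a) w) (*) \<phi>"
    and val: "\<forall>w\<in>insert v B. \<phi> w = (if w = v then 1 else 0)" by blast
  have "v \<notin> B" using v V.span_base by blast
  then have "\<phi> w = 0" if "w \<in> B" for w using val that by auto
  then have "\<phi> w = 0" if "w \<in> S" for w
    using P.linear_eq_0_on_span[OF lin, of B w] B(3) that by blast
  moreover have "\<phi> v = 1" using val by simp
  moreover have "\<phi> (u + w) = \<phi> u + \<phi> w" "\<phi> (smult (lC a) w) = a * \<phi> w" for u w a
    using P.linear_add[OF lin] P.linear_scale[OF lin] by auto
  ultimately show thesis using that by blast
qed

context lca_rule
begin

text \<open>
  Row vectors over \<open>L\<close> are encoded as the coefficient sequences of polynomials, which form a group as a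
  type; the variable has nothing to do with that of the characteristic polynomial.
\<close>

definition shifted_row :: "nat \<Rightarrow> int \<Rightarrow> nat \<Rightarrow> 'a laurent poly" where
  "shifted_row t x k = (\<Sum>l<n. monom (lX x * (A ^\<^sub>m t) $$ (k,l)) l)"

lemma coeff_shifted_row: "l < n \<Longrightarrow> coeff (shifted_row t x k) l = lX x * (A ^\<^sub>m t) $$ (k,l)"
  by (simp add: shifted_row_def coeff_sum)

text \<open>Otherwise some functional kills all these rows but not \<open>X^y e_i\<close>. Its
  values on the vectors \<open>X^(-x) e_l\<close> form a nonzero configuration whose orbit vanishes
  on the window.\<close>

lemma span_shifted_rows:
  assumes M: "\<And>c. is_config n c \<Longrightarrow> (\<And>t x. \<bar>x\<bar> \<le> int M \<Longrightarrow> (F ^^ t) c x = 0\<^sub>v n) \<Longrightarrow> c = (\<lambda>_. 0\<^sub>v n)"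
    and i: "i < n"
  shows "monom (lX y) i \<in> module.span (\<lambda>a w. smult (lC a) w)
    {shifted_row t x k | t x k. \<bar>x\<bar> \<le> int M \<and> k < n}" (is "?v \<in> module.span _ ?S")
proof (rule ccontr)
  assume "?v \<notin> module.span (\<lambda>a w. smult (lC a) w) ?S"
  then obtain \<phi> where add: "\<And>u w. \<phi> (u + w) = \<phi> u + \<phi> w"
    and scale: "\<And>a w. \<phi> (smult (lC a) w) = a * \<phi> w"
    and S: "\<And>w. w \<in> ?S \<Longrightarrow> \<phi> w = 0" and v: "\<phi> ?v = 1"
    by (rule separating_functional) blast
  have zero: "\<phi> 0 = 0" using scale[of 0 0] by simp
  have sum: "\<phi> (\<Sum>l\<in>L. f l) = (\<Sum>l\<in>L. \<phi> (f l))" for L and f :: "nat \<Rightarrow> _"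
    by (induction L rule: infinite_finite_induct) (auto simp: zero add)
  define c where "c x = vec n (\<lambda>l. \<phi> (monom (lX (- x)) l))" for x
  have c: "is_config n c" by (simp add: is_config_def c_def)
  have func: "laurent_functional (\<lambda>f. \<phi> (monom f l))" for l
    by (simp add: laurent_functional_def add_monom[symmetric] add smult_monom[symmetric] scale)
  have "(F ^^ t) c x = 0\<^sub>v n" if x: "\<bar>x\<bar> \<le> int M" for t x
  proof (rule eq_vecI)
    show dim: "dim_vec ((F ^^ t) c x) = dim_vec (0\<^sub>v n)"
      using lca_power_config[OF c, of t] by (simp add: is_config_def)
    fix k assume "k < dim_vec (0\<^sub>v n :: 'a vec)"
    then have k: "k < n" by simp
    have "(F ^^ t) c x $ k = (\<Sum>l<n. \<phi> (monom (lX (- x) * (A ^\<^sub>m t) $$ (k,l)) l))"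
      by (rule lca_power_functional[OF c func _ k]) (simp_all add: c_def)
    also have "\<dots> = \<phi> (shifted_row t (- x) k)" by (simp add: shifted_row_def sum)
    also have "\<dots> = 0" using x k by (intro S CollectI exI[of _ t] exI[of _ "- x"] exI[of _ k]) auto
    finally show "(F ^^ t) c x $ k = 0\<^sub>v n $ k" using k by simp
  qed
  then have "c = (\<lambda>_. 0\<^sub>v n)" by (intro M c)
  \<comment> \<open>Cell \<open>- y\<close> is the one that records the value of
    \<open>\<phi>\<close> at \<open>X^y e_i\<close>.\<close>
  then have "c (- y) $ i = 0" using i by simp
  then show False using i v by (simp add: c_def)
qed

text \<open>Modulo the rows of \<open>t I - A\<close>, row \<open>k\<close> of
  \<open>X^x A^j\<close> becomes \<open>X^x t^j e_k\<close>, so reduction leaves only exponents of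
  \<open>X\<close> in \<open>[-M, M]\<close>.\<close>

lemma span_shifted_rows_mod_char_poly_matrix:
  assumes "w \<in> module.span (\<lambda>a w. smult (lC a) w)
    {shifted_row t x k | t x k. \<bar>x\<bar> \<le> int M \<and> k < n}"
  shows "\<exists>q B. (\<forall>l i x. int M < \<bar>x\<bar> \<longrightarrow> Poly_Mapping.lookup (coeff (q l) i) x = 0) \<and>
    (\<forall>l<n. q l - [:coeff w l:] = (\<Sum>k<n. B k * char_poly_matrix A $$ (k,l)))" (is "\<exists>q B. ?P w q B")
proof -
  interpret V: vector_space "\<lambda>a (w :: 'a laurent poly). smult (lC a) w" by (rule laurent_vector_space)
  from assms show ?thesis
  proof (induction rule: V.span_induct_alt)
    case base
    show ?case by (intro exI[of _ "\<lambda>_. 0"]) auto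
  next
    case (step a w u)
    then obtain q B where P: "?P u q B" by blast
    from step obtain t x k where w: "w = shifted_row t x k" and x: "\<bar>x\<bar> \<le> int M" and k: "k < n" by blast
    from monom_minus_power_dvd_char_poly_matrix[OF laurent_matrix_carrier[of n r Aj], of t]
    obtain G where G: "G \<in> carrier_mat n n"
      and eq: "monom 1 t \<cdot>\<^sub>m 1\<^sub>m n - map_mat (\<lambda>a. [:a:]) (A ^\<^sub>m t) = G * char_poly_matrix A" by blast
    let ?f = "Poly_Mapping.single x a"
    \<comment> \<open>The new summand is \<open>?f\<close> times row \<open>k\<close> of
      \<open>A^t\<close>: its reduced form goes into slot \<open>k\<close> of \<open>q\<close>, and
      the error is \<open>?f\<close> times row \<open>k\<close> of \<open>G\<close>.\<close>
    define q' where "q' l = q l + (if l = k then monom ?f t else 0)" for l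
    define B' where "B' m = B m + [:?f:] * G $$ (k,m)" for m
    have "q' l - [:coeff (smult (lC a) w + u) l:] = (\<Sum>m<n. B' m * char_poly_matrix A $$ (m,l))" if l: "l < n" for l
    proof -
      have c: "char_poly_matrix A \<in> carrier_mat n n" by simp
      have "(if l = k then monom 1 t else 0) - [:(A ^\<^sub>m t) $$ (k,l):]
          = (monom 1 t \<cdot>\<^sub>m 1\<^sub>m n - map_mat (\<lambda>a. [:a:]) (A ^\<^sub>m t)) $$ (k,l)"
        using k l carrier_matD[OF pow_carrier_mat[OF laurent_matrix_carrier[of n r Aj], of t]] by auto
      also have "\<dots> = (\<Sum>m<n. G $$ (k,m) * char_poly_matrix A $$ (m,l))"
        unfolding eq using G carrier_matD[OF c] k l by (simp add: scalar_prod_def lessThan_atLeast0)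
      finally have *: "(if l = k then monom 1 t else 0) - [:(A ^\<^sub>m t) $$ (k,l):]
        = (\<Sum>m<n. G $$ (k,m) * char_poly_matrix A $$ (m,l))" .
      have "coeff (smult (lC a) w) l = ?f * (A ^\<^sub>m t) $$ (k,l)"
        using l by (simp add: w coeff_shifted_row mult.assoc[symmetric] mult_single)
      then have "q' l - [:coeff (smult (lC a) w + u) l:] = (q l - [:coeff u l:])
          + [:?f:] * ((if l = k then monom 1 t else 0) - [:(A ^\<^sub>m t) $$ (k,l):])"
        by (auto simp: q'_def smult_monom right_diff_distrib)
      also have "\<dots> = (\<Sum>m<n. B' m * char_poly_matrix A $$ (m,l))"
        unfolding * using P l
        by (simp add: B'_def distrib_right sum.distrib sum_distrib_left mult.assoc)
      finally show ?thesis .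
    qed
    moreover have "Poly_Mapping.lookup (coeff (q' l) i) y = 0" if "int M < \<bar>y\<bar>" for l i y
      using that P x by (auto simp: q'_def lookup_add lookup_single when_def)
    ultimately show ?case by blast
  qed
qed

text \<open>The reductions of the vectors \<open>X^(-sS) e_i\<close> form the rows of the matrix
  \<open>Q\<close> needed by \<open>constant_term_dominates_char_poly\<close>.\<close>

lemma window_imp_constant_term_dominates:
  assumes M: "\<And>c. is_config n c \<Longrightarrow> (\<And>t x. \<bar>x\<bar> \<le> int M \<Longrightarrow> (F ^^ t) c x = 0\<^sub>v n) \<Longrightarrow> c = (\<lambda>_. 0\<^sub>v n)"
    and n: "n > 0" and s: "s * s = 1"
  shows "constant_term_dominates s (char_poly A)"
proof -
  \<comment> \<open>One more than \<open>M\<close>, so that exponents \<open>m \<le> - ?S\<close>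
    fall outside the range of \<open>Q\<close> for either sign.\<close>
  let ?S = "int M + 1"
  let ?x = "- (s * ?S)"
  have s': "\<bar>s * m\<bar> = \<bar>m\<bar>" for m
    using s by (auto simp: abs_mult zmult_eq_1_iff)
  have "\<forall>i. \<exists>q B. i < n \<longrightarrow> (\<forall>l j x. int M < \<bar>x\<bar> \<longrightarrow> Poly_Mapping.lookup (coeff (q l) j) x = 0) \<and>
    (\<forall>l<n. q l - [:coeff (monom (lX ?x :: 'a laurent) i) l:] = (\<Sum>k<n. B k * char_poly_matrix A $$ (k,l)))"
  proof
    fix i
    show "\<exists>q B. i < n \<longrightarrow> (\<forall>l j x. int M < \<bar>x\<bar> \<longrightarrow> Poly_Mapping.lookup (coeff (q l) j) x = 0) \<and>
      (\<forall>l<n. q l - [:coeff (monom (lX ?x :: 'a laurent) i) l:] = (\<Sum>k<n. B k * char_poly_matrix A $$ (k,l)))"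
    proof (cases "i < n")
      case True
      have "monom (lX ?x :: 'a laurent) i \<in> module.span (\<lambda>a w. smult (lC a) w)
          {shifted_row t x k | t x k. \<bar>x\<bar> \<le> int M \<and> k < n}"
        by (rule span_shifted_rows[OF _ True]) (rule M)
      from span_shifted_rows_mod_char_poly_matrix[OF this] show ?thesis by blast
    qed simp
  qed
  from choice[OF this] obtain q where "\<forall>i. \<exists>B. i < n \<longrightarrow>
      (\<forall>l j x. int M < \<bar>x\<bar> \<longrightarrow> Poly_Mapping.lookup (coeff (q i l) j) x = 0) \<and>
      (\<forall>l<n. q i l - [:coeff (monom (lX ?x :: 'a laurent) i) l:] = (\<Sum>k<n. B k * char_poly_matrix A $$ (k,l)))" ..
  from choice[OF this] obtain B where B: "\<forall>i. i < n \<longrightarrow>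
      (\<forall>l j x. int M < \<bar>x\<bar> \<longrightarrow> Poly_Mapping.lookup (coeff (q i l) j) x = 0) \<and>
      (\<forall>l<n. q i l - [:coeff (monom (lX ?x :: 'a laurent) i) l:] = (\<Sum>k<n. B i k * char_poly_matrix A $$ (k,l)))" ..
  have qB1: "Poly_Mapping.lookup (coeff (q i l) j) x = 0" if "i < n" "int M < \<bar>x\<bar>" for i l j x
    using B that by blast
  have qB2: "q i l - [:coeff (monom (lX ?x :: 'a laurent) i) l:] = (\<Sum>k<n. B i k * char_poly_matrix A $$ (k,l))"
    if "i < n" "l < n" for i l
    using B that by blast
  define Q where "Q = mat n n (\<lambda>(i,l). q i l)"
  \<comment> \<open>Negated because \<open>B\<close> expresses \<open>Q\<close> minus the monomial,
    whereas \<open>eq\<close> has \<open>Q\<close> subtracted.\<close>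
  define B' where "B' = mat n n (\<lambda>(i,k). - B i k)"
  have c: "char_poly_matrix A \<in> carrier_mat n n" by simp
  have eq: "[:lX ?x:] \<cdot>\<^sub>m 1\<^sub>m n - Q = B' * char_poly_matrix A"
  proof (rule eq_matI)
    fix i l assume "i < dim_row (B' * char_poly_matrix A)" "l < dim_col (B' * char_poly_matrix A)"
    then have il: "i < n" "l < n" using c by (auto simp: B'_def)
    have "(B' * char_poly_matrix A) $$ (i,l) = - (\<Sum>k<n. B i k * char_poly_matrix A $$ (k,l))"
      using il carrier_matD[OF c]
      by (simp add: B'_def scalar_prod_def lessThan_atLeast0 sum_negf)
    also have "\<dots> = [:coeff (monom (lX ?x) i) l:] - q i l"
      unfolding qB2[OF il, symmetric] by simp
    finally show "([:lX ?x:] \<cdot>\<^sub>m 1\<^sub>m n - Q) $$ (i,l) = (B' * char_poly_matrix A) $$ (i,l)"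
      using il by (auto simp: Q_def)
  qed (use carrier_matD[OF c] in \<open>auto simp: B'_def Q_def\<close>)
  show ?thesis
  proof (rule constant_term_dominates_char_poly[OF laurent_matrix_carrier n s _ _ eq])
    fix i j k m assume "i < n" "j < n" "m \<le> - ?S"
    then show "Poly_Mapping.lookup (coeff (Q $$ (i,j)) k) (s * m) = 0"
      using qB1[of i "s * m" j k] by (simp add: Q_def s')
  qed (simp_all add: Q_def B'_def)
qed

section \<open>Expansivity implies positive expansivity\<close>

text \<open>This is Cayley--Hamilton paired with the configuration at time \<open>t\<close>, taken
  as the new origin of time; \<open>X^j\<close> turns into the shift from \<open>x\<close> to
  \<open>x - j\<close>.\<close>

lemma char_poly_recurrence:
  assumes c: "is_config n c" and k: "k < n"
    and supp: "\<And>i. Poly_Mapping.keys (coeff (char_poly A) i) \<subseteq> {u..v}"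
  shows "(\<Sum>i\<le>n. \<Sum>j\<in>{u..v}. Poly_Mapping.lookup (coeff (char_poly A) i) j * (F ^^ (i + t)) c (x - j) $ k) = 0"
proof -
  let ?c = "(F ^^ t) c" and ?\<chi> = "char_poly A"
  let ?\<phi> = "\<lambda>l. pairing (\<lambda>y. ?c y $ l)"
  have c': "is_config n ?c" by (rule lca_power_config[OF c])
  have f: "laurent_functional (?\<phi> l)" for l by (rule laurent_functional_pairing)
  have expand: "(\<Sum>j\<in>{u..v}. Poly_Mapping.lookup (coeff ?\<chi> i) j * ?\<phi> l (lX (- (x - j)) * g))
      = ?\<phi> l (lX (- x) * (coeff ?\<chi> i * g))" for i l g
  proof -
    have "coeff ?\<chi> i = (\<Sum>j\<in>Poly_Mapping.keys (coeff ?\<chi> i). Poly_Mapping.single j (Poly_Mapping.lookup (coeff ?\<chi> i) j))"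
      by (rule poly_mapping_sum_single)
    also have "\<dots> = (\<Sum>j\<in>{u..v}. Poly_Mapping.single j (Poly_Mapping.lookup (coeff ?\<chi> i) j))"
      using supp[of i] by (intro sum.mono_neutral_left) (auto simp: in_keys_iff)
    finally have "lX (- x) * (coeff ?\<chi> i * g)
        = lX (- x) * ((\<Sum>j\<in>{u..v}. Poly_Mapping.single j (Poly_Mapping.lookup (coeff ?\<chi> i) j)) * g)"
      by (rule arg_cong)
    also have "\<dots> = (\<Sum>j\<in>{u..v}. lX (- x) * Poly_Mapping.single j (Poly_Mapping.lookup (coeff ?\<chi> i) j) * g)"
      by (simp only: sum_distrib_left sum_distrib_right mult.assoc)
    also have "\<dots> = (\<Sum>j\<in>{u..v}. Poly_Mapping.single (- (x - j)) (Poly_Mapping.lookup (coeff ?\<chi> i) j) * g)"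
      by (simp add: mult_single)
    finally show ?thesis
      by (simp only: laurent_functional_sum[OF f])
        (intro sum.cong refl laurent_functional_single[OF f, symmetric])
  qed
  have "(\<Sum>i\<le>n. \<Sum>j\<in>{u..v}. Poly_Mapping.lookup (coeff ?\<chi> i) j * (F ^^ (i + t)) c (x - j) $ k)
      = (\<Sum>i\<le>n. \<Sum>j\<in>{u..v}. \<Sum>l<n. Poly_Mapping.lookup (coeff ?\<chi> i) j * ?\<phi> l (lX (- (x - j)) * (A ^\<^sub>m i) $$ (k,l)))"
    unfolding funpow_add o_apply lca_power_pairing[OF c' k] sum_distrib_left ..
  also have "\<dots> = (\<Sum>i\<le>n. \<Sum>l<n. \<Sum>j\<in>{u..v}. Poly_Mapping.lookup (coeff ?\<chi> i) j * ?\<phi> l (lX (- (x - j)) * (A ^\<^sub>m i) $$ (k,l)))"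
    by (intro sum.cong refl sum.swap)
  also have "\<dots> = (\<Sum>i\<le>n. \<Sum>l<n. ?\<phi> l (lX (- x) * (coeff ?\<chi> i * (A ^\<^sub>m i) $$ (k,l))))"
    by (simp only: expand)
  also have "\<dots> = (\<Sum>l<n. \<Sum>i\<le>n. ?\<phi> l (lX (- x) * (coeff ?\<chi> i * (A ^\<^sub>m i) $$ (k,l))))"
    by (rule sum.swap)
  also have "\<dots> = (\<Sum>l<n. ?\<phi> l (lX (- x) * (\<Sum>i\<le>n. coeff ?\<chi> i * (A ^\<^sub>m i) $$ (k,l))))"
    by (simp only: sum_distrib_left laurent_functional_sum[OF f])
  also have "\<dots> = 0"
  proof (intro sum.neutral ballI)
    fix l assume "l \<in> {..<n}"
    then have "(\<Sum>i\<le>n. coeff ?\<chi> i * (A ^\<^sub>m i) $$ (k,l)) = 0"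
      using k by (intro cayley_hamilton_entry[OF laurent_matrix_carrier]) auto
    then show "?\<phi> l (lX (- x) * (\<Sum>i\<le>n. coeff ?\<chi> i * (A ^\<^sub>m i) $$ (k,l))) = 0"
      by (simp add: pairing_def)
  qed
  finally show ?thesis .
qed

end

text \<open>In the relation at \<open>x + v\<close>, the term \<open>a 0 v * y t x\<close> is the
  only one with \<open>j = v\<close> that survives; all others sit in the \<open>v - u\<close> cells
  to the right of \<open>x\<close>. Zeros therefore spread left one cell at a time.\<close>

lemma recurrence_zero_left:
  fixes y :: "nat \<Rightarrow> int \<Rightarrow> 'a::field" and a :: "nat \<Rightarrow> int \<Rightarrow> 'a"
  assumes rec: "\<And>t x. (\<Sum>i\<le>n. \<Sum>j\<in>{u..v}. a i j * y (i + t) (x - j)) = 0"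
    and a0: "a 0 v \<noteq> 0" and ai: "\<And>i. i > 0 \<Longrightarrow> a i v = 0"
    and uv: "u \<le> v" and window: "\<And>t x. w \<le> x \<Longrightarrow> x < w + (v - u) \<Longrightarrow> y t x = 0"
    and x: "x < w + (v - u)"
  shows "y t x = 0"
proof -
  \<comment> \<open>The relation involves the later times \<open>i + t\<close>, so each cell is
    cleared for all times at once.\<close>
  have "\<forall>t x. w - int N \<le> x \<and> x < w + (v - u) \<longrightarrow> y t x = 0" for N
  proof (induction N)
    case 0
    then show ?case using window by auto
  next
    case (Suc N)
    have "y t (w - int (Suc N)) = 0" for t
    proof -
      let ?x = "w - int (Suc N)"
      have z: "a i j * y (i + t) (?x + v - j) = 0" if "i \<le> n" "j \<in> {u..v}" "i \<noteq> 0 \<or> j \<noteq> v" for i j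
      proof (cases "j = v")
        case False
        then have "w - int N \<le> ?x + v - j" "?x + v - j < w + (v - u)" using that by auto
        then show ?thesis using Suc by simp
      qed (use that ai in auto)
      have "(\<Sum>i\<le>n. \<Sum>j\<in>{u..v}. a i j * y (i + t) (?x + v - j)) = (\<Sum>j\<in>{u..v}. a 0 j * y (0 + t) (?x + v - j))"
        using z by (subst sum.mono_neutral_right[of "{..n}" "{0}"]) (auto intro!: sum.neutral)
      also have "\<dots> = a 0 v * y (0 + t) (?x + v - v)"
        using z[of 0] uv by (subst sum.mono_neutral_right[of "{u..v}" "{v}"]) auto
      finally show ?thesis using rec[of t "?x + v"] a0 by simp
    qed
    moreover have "w - int N \<le> x" if "w - int (Suc N) \<le> x" "x \<noteq> w - int (Suc N)" for x
      using that by simp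
    ultimately show ?case using Suc by blast
  qed
  from this[of "nat (w - x)"] show ?thesis using x by auto
qed

text \<open>Reflecting \<open>x\<close> and \<open>j\<close> exchanges the roles of \<open>u\<close>
  and \<open>v\<close> and reduces this to leftward propagation.\<close>

lemma recurrence_zero_right:
  fixes y :: "nat \<Rightarrow> int \<Rightarrow> 'a::field" and a :: "nat \<Rightarrow> int \<Rightarrow> 'a"
  assumes rec: "\<And>t x. (\<Sum>i\<le>n. \<Sum>j\<in>{u..v}. a i j * y (i + t) (x - j)) = 0"
    and a0: "a 0 u \<noteq> 0" and ai: "\<And>i. i > 0 \<Longrightarrow> a i u = 0"
    and uv: "u \<le> v" and window: "\<And>t x. x \<le> w \<Longrightarrow> w - (v - u) < x \<Longrightarrow> y t x = 0"
    and x: "w - (v - u) < x"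
  shows "y t x = 0"
proof -
  have "(\<Sum>i\<le>n. \<Sum>j\<in>{-v..-u}. a i (- j) * y (i + t) (- (x - j))) = 0" for t x
  proof -
    have "(\<Sum>j\<in>{-v..-u}. a i (- j) * y (i + t) (- (x - j))) = (\<Sum>j\<in>{u..v}. a i j * y (i + t) (- x - j))" for i
      by (rule sum.reindex_bij_witness[of _ uminus uminus]) auto
    then show ?thesis using rec[of t "- x"] by simp
  qed
  from recurrence_zero_left[where a = "\<lambda>i j. a i (- j)" and y = "\<lambda>t x. y t (- x)", OF this,
      of "- w" "- x" t]
  show ?thesis using assms by simp
qed

context lca_rule
begin

text \<open>All coefficients of \<open>\<chi>\<close> are supported in \<open>[u, v]\<close>, and
  both endpoints occur only in the constant term, so zeros propagate both ways. A window of radius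
  \<open>v - u\<close> contains the \<open>v - u\<close> consecutive cells that each direction
  starts from.\<close>

lemma constant_term_dominates_imp_window:
  assumes "constant_term_dominates 1 (char_poly A)" "constant_term_dominates (- 1) (char_poly A)"
  shows "\<exists>M::nat. \<forall>c. is_config n c \<longrightarrow> (\<forall>t x. \<bar>x\<bar> \<le> int M \<longrightarrow> (F ^^ t) c x = 0\<^sub>v n) \<longrightarrow> c = (\<lambda>_. 0\<^sub>v n)"
proof -
  define a where "a i = Poly_Mapping.lookup (coeff (char_poly A) i)" for i
  from assms(1) obtain u where u: "u < 0" "a 0 u \<noteq> 0" "\<And>k. k < u \<Longrightarrow> a 0 k = 0"
      "\<And>i k. i > 0 \<Longrightarrow> k \<le> u \<Longrightarrow> a i k = 0"
    unfolding constant_term_dominates_def a_def by auto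
  from assms(2) obtain v' where v': "v' < 0" "a 0 (- v') \<noteq> 0" "\<And>k. k < v' \<Longrightarrow> a 0 (- k) = 0"
      "\<And>i k. i > 0 \<Longrightarrow> k \<le> v' \<Longrightarrow> a i (- k) = 0"
    unfolding constant_term_dominates_def a_def by auto
  define v where "v = - v'"
  have v: "v > 0" "a 0 v \<noteq> 0" "\<And>k. k > v \<Longrightarrow> a 0 k = 0" "\<And>i k. i > 0 \<Longrightarrow> k \<ge> v \<Longrightarrow> a i k = 0"
  proof -
    show "v > 0" "a 0 v \<noteq> 0" using v' by (simp_all add: v_def)
    show "a 0 k = 0" if "k > v" for k using v'(3)[of "- k"] that by (simp add: v_def)
    show "a i k = 0" if "i > 0" "k \<ge> v" for i k using v'(4)[of i "- k"] that by (simp add: v_def)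
  qed
  have supp: "Poly_Mapping.keys (coeff (char_poly A) i) \<subseteq> {u..v}" for i
  proof
    fix k assume "k \<in> Poly_Mapping.keys (coeff (char_poly A) i)"
    then have "a i k \<noteq> 0" by (simp add: a_def in_keys_iff)
    then show "k \<in> {u..v}"
      using u(3)[of k] u(4)[of i k] v(3)[of k] v(4)[of i k] by (cases "i = 0") force+
  qed
  have "c = (\<lambda>_. 0\<^sub>v n)"
    if c: "is_config n c" and w: "\<And>t x. \<bar>x\<bar> \<le> v - u \<Longrightarrow> (F ^^ t) c x = 0\<^sub>v n" for c
  proof (intro ext eq_vecI)
    fix x
    show "dim_vec (c x) = dim_vec (0\<^sub>v n)" using c by (simp add: is_config_def)
    fix k assume "k < dim_vec (0\<^sub>v n :: 'a vec)"
    then have k: "k < n" by simp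
    define y where "y t x = (F ^^ t) c x $ k" for t x
    have rec: "(\<Sum>i\<le>n. \<Sum>j\<in>{u..v}. a i j * y (i + t) (x - j)) = 0" for t x
      unfolding a_def y_def by (rule char_poly_recurrence[OF c k supp])
    have window: "y t x = 0" if "\<bar>x\<bar> \<le> v - u" for t x
      using w[OF that] k by (simp add: y_def)
    have "y 0 x = 0"
    \<comment> \<open>Starting at \<open>w = 0\<close>, leftward propagation reaches every
      \<open>x < v - u\<close> and rightward propagation every \<open>x > - (v - u)\<close>.\<close>
    proof (cases "x < v - u")
      case True
      show ?thesis
        by (rule recurrence_zero_left[where a = a and y = y and w = 0, OF rec])
          (use u v True window in auto)
    next
      case False
      show ?thesis
        by (rule recurrence_zero_right[where a = a and y = y and w = 0, OF rec])
          (use u v False window in auto)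
    qed
    then show "c x $ k = 0\<^sub>v n $ k" using k by (simp add: y_def)
  qed
  then show ?thesis using u v by (intro exI[of _ "nat (v - u)"]) auto
qed

end

section \<open>Comparison with the degree conditions\<close>

lemma expansive_poly_iff_constant_term_dominates:
  fixes p :: "'a::comm_ring_1 laurent poly"
  assumes n: "n > 0" and deg: "degree p = n" and monic: "coeff p n = 1"
  shows "expansive_poly (map_poly (laurent_to_fls 1 (\<lambda>a. a)) p) \<longleftrightarrow>
    constant_term_dominates 1 p \<and> constant_term_dominates (- 1) p"
proof -
  let ?h = "laurent_to_fls 1 (\<lambda>a :: 'a. a)" and ?L = "Poly_Mapping.lookup :: 'a laurent \<Rightarrow> _"
  have nth: "fls_nth (?h f) m = ?L f m" for f m
    using comm_ring_hom.laurent_to_fls_nth[OF id_hom, of 1 f m] by simp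
  have h0: "?h f = 0 \<longleftrightarrow> f = 0" for f
    unfolding fls_eq_iff poly_mapping_eq_iff fun_eq_iff by (simp add: nth)
  have zero: "?h 0 = 0" by (simp add: h0)
  have one: "?h 1 = 1"
    by (rule fls_eqI) (simp add: nth lookup_one when_def)
  have coeffs: "coeff (map_poly ?h p) i = ?h (coeff p i)" for i by (simp add: coeff_map_poly zero)
  have "degree (map_poly ?h p) \<le> n" using degree_map_poly_le[of ?h p] deg by simp
  moreover have "n \<le> degree (map_poly ?h p)" by (rule le_degree) (simp add: coeffs monic one)
  ultimately have degh: "degree (map_poly ?h p) = n" by simp

  \<comment> \<open>The order of \<open>f\<close> in powers of \<open>X^s\<close>; negating
    \<open>deg_plus\<close> gives both halves of expansivity the same form.\<close>
  define lo where "lo s f = (if s = 1 then deg_minus (?h f) else - deg_plus (?h f))" for s :: int and f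
  have lo: "?L f (s * lo s f) \<noteq> 0" "k < lo s f \<Longrightarrow> ?L f (s * k) = 0"
    if f: "f \<noteq> 0" and s: "s = 1 \<or> s = - 1" for f s k
  proof -
    have ne: "Poly_Mapping.keys f \<noteq> {}" using f by simp
    have plus: "deg_plus (?h f) = Max (Poly_Mapping.keys f)"
      by (simp add: deg_plus_def nth Poly_Mapping.keys.rep_eq)
    show "?L f (s * lo s f) \<noteq> 0"
    proof (cases "s = 1")
      case True
      then show ?thesis
        using nth_fls_subdegree_nonzero[of "?h f"] f by (simp add: lo_def deg_minus_def nth h0)
    next
      case False
      then show ?thesis
        using s Max_in[OF finite_keys ne] by (simp add: lo_def plus in_keys_iff)
    qed
    show "?L f (s * k) = 0" if k: "k < lo s f"
    proof (cases "s = 1")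
      case True
      then show ?thesis
        using fls_eq0_below_subdegree[of k "?h f"] k by (simp add: lo_def deg_minus_def nth)
    next
      case False
      then have "Max (Poly_Mapping.keys f) < s * k" using s k by (simp add: lo_def plus)
      then have "s * k \<notin> Poly_Mapping.keys f" using Max_ge[OF finite_keys, of "s * k" f] by linarith
      then show ?thesis by (simp add: in_keys_iff)
    qed
  qed
  \<comment> \<open>The disjunct \<open>f = 0\<close> carries the conventions for the degrees of
    zero.\<close>
  have less: "(f = 0 \<or> m < lo s f) \<longleftrightarrow> (\<forall>k\<le>m. ?L f (s * k) = 0)" if s: "s = 1 \<or> s = - 1" for f m s
  proof (cases "f = 0")
    case False
    show ?thesis
    proof (cases "m < lo s f")
      case True
      then show ?thesis using lo(2)[OF False s] by auto
    next
      case F: False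
      then have "\<not> (\<forall>k\<le>m. ?L f (s * k) = 0)" using lo(1)[OF False s] by (intro notI) auto
      then show ?thesis using F False by simp
    qed
  qed simp
  have dominates: "constant_term_dominates s p \<longleftrightarrow> coeff p 0 \<noteq> 0 \<and> lo s (coeff p 0) < 0 \<and>
      (\<forall>i\<in>{1..<n}. coeff p i = 0 \<or> lo s (coeff p 0) < lo s (coeff p i))" (is "_ \<longleftrightarrow> ?R")
    if s: "s = 1 \<or> s = - 1" for s
  proof
    assume "constant_term_dominates s p"
    then obtain m where m: "m < 0" "?L (coeff p 0) (s * m) \<noteq> 0" "\<And>k. k < m \<Longrightarrow> ?L (coeff p 0) (s * k) = 0"
      and i: "\<And>i k. i > 0 \<Longrightarrow> k \<le> m \<Longrightarrow> ?L (coeff p i) (s * k) = 0"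
      unfolding constant_term_dominates_def by blast
    have nz: "coeff p 0 \<noteq> 0" using m(2) by auto
    have "\<not> m < lo s (coeff p 0)" using lo(2)[OF nz s] m(2) by blast
    moreover have "\<not> lo s (coeff p 0) < m" using lo(1)[OF nz s] m(3) by blast
    ultimately have "lo s (coeff p 0) = m" by simp
    then show ?R using nz m(1) i less[OF s] by auto
  next
    assume R: ?R
    have "?L (coeff p i) (s * k) = 0" if "i > 0" "k \<le> lo s (coeff p 0)" for i k
    proof -
      consider "i \<in> {1..<n}" | "i = n" | "i > n" using \<open>i > 0\<close> by fastforce
      then show ?thesis
      proof cases
        case 1
        then show ?thesis using R less[OF s, of "coeff p i" "lo s (coeff p 0)"] that by blast
      next
        case 2
        \<comment> \<open>The leading coefficient \<open>1\<close> lives at exponent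
          \<open>0\<close>, while \<open>k\<close> is negative.\<close>
        have "s * k \<noteq> 0" using R that s by auto
        then show ?thesis by (simp add: 2 monic lookup_one)
      next
        case 3
        then show ?thesis using deg by (simp add: coeff_eq_0)
      qed
    qed
    then show "constant_term_dominates s p"
      unfolding constant_term_dominates_def using R lo[of "coeff p 0" s] s
      by (intro exI[of _ "lo s (coeff p 0)"]) blast
  qed
  show ?thesis
    unfolding dominates[of 1, simplified] dominates[of "- 1", simplified] expansive_poly_def degh coeffs h0
    by (auto simp: lo_def)
qed

theorem theorem1:
  fixes n r :: nat and Aj :: "int \<Rightarrow> 'p::prime_card mod_ring mat"
  assumes "n > 1"
    and "\<And>j. j \<in> {-int r..int r} \<Longrightarrow> Aj j \<in> carrier_mat n n"
  shows "positively_expansive n (lca n r Aj) \<longleftrightarrow> expansive_mat (lca_matrix n r Aj)"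
proof -
  interpret lca_rule n r Aj using assms(2) by unfold_locales
  interpret i: comm_ring_hom "\<lambda>a :: 'p mod_ring. a" by (rule id_hom)
  interpret h: comm_ring_hom "laurent_to_fls 1 (\<lambda>a :: 'p mod_ring. a)"
    by (rule i.laurent_to_fls_hom) simp
  let ?D = "\<lambda>s. constant_term_dominates s (char_poly A)"
  have n: "n > 0" using assms(1) by simp
  have "positively_expansive n (lca n r Aj) \<longleftrightarrow> ?D 1 \<and> ?D (- 1)"
  proof
    assume "positively_expansive n (lca n r Aj)"
    then obtain M where M: "c = (\<lambda>_. 0\<^sub>v n)"
      if "is_config n c" "\<And>t x. \<bar>x\<bar> \<le> int M \<Longrightarrow> (F ^^ t) c x = 0\<^sub>v n" for c
      unfolding positively_expansive_iff_window by blast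
    have "?D s" if "s * s = 1" for s
      by (rule window_imp_constant_term_dominates[OF _ n that]) (rule M)
    then show "?D 1 \<and> ?D (- 1)" by simp
  next
    assume "?D 1 \<and> ?D (- 1)"
    then show "positively_expansive n (lca n r Aj)"
      unfolding positively_expansive_iff_window using constant_term_dominates_imp_window by blast
  qed
  also have "\<dots> \<longleftrightarrow> expansive_poly (map_poly (laurent_to_fls 1 (\<lambda>a. a)) (char_poly A))"
    using degree_monic_char_poly[OF laurent_matrix_carrier] n
    by (subst expansive_poly_iff_constant_term_dominates[of n]) auto
  \<comment> \<open>Characteristic polynomials commute with ring homomorphisms, here the embedding
    into Laurent series.\<close>
  also have "\<dots> \<longleftrightarrow> expansive_mat (lca_matrix n r Aj)"
    unfolding expansive_mat_def lca_matrix_eq_map_laurent h.char_poly_hom[OF laurent_matrix_carrier] ..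
  finally show ?thesis .
qed

end
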